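(* Let $\mathbb{F}$ be $\mathbb{R}$ or $\mathbb{C}$. Let $W$ be a word in the letters $A,B$ for which there are positive definite matrices $A,B$ over $\mathbb{F}$ (of the same size) such that $W(A,B)$ has an eigenvalue that is not positive. Then, for every positive integer $k$, there are positive definite matrices $A',B'$ over $\mathbb{F}$ (of the same size as each other) such that $W(A',B')^k$ has an eigenvalue that is not positive.
   Context: A word is a finite sequence of letters from the alphabet $\{A,B\}$ (repetition allowed), and $W(A,B)$ denotes the matrix product obtained by substituting square matrices of equal size for the letters. Positive definite means real symmetric positive definite when $\mathbb{F}=\mathbb{R}$ and complex Hermitian positive definite when $\mathbb{F}=\mathbb{C}$. Eigenvalues are taken in $\mathbb{C}$; an eigenvalue is "not positive" (nonpositive) if it is not a positive real number, so it may be non-real. *)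

theory Defs
  imports "Jordan_Normal_Form.Schur_Decomposition"
begin

datatype letter = LA | LB

primrec letter_mat :: "letter \<Rightarrow> 'a mat \<Rightarrow> 'a mat \<Rightarrow> 'a mat" where
  "letter_mat LA A B = A"
| "letter_mat LB A B = B"

(* W(A,B); the empty word evaluates to the identity matrix of the size of A. *)
primrec word_mat :: "letter list \<Rightarrow> 'a::semiring_1 mat \<Rightarrow> 'a mat \<Rightarrow> 'a mat" where
  "word_mat [] A B = 1\<^sub>m (dim_row A)"
| "word_mat (x # W) A B = letter_mat x A B * word_mat W A B"

(* On real, conjugate is the identity, so mat_adjoint is the transpose.  On complex, the order is
   that of Complex_Order: 0 < z says that z is real and positive. *)
definition positive_definite :: "'a::conjugatable_ordered_field mat \<Rightarrow> bool" where
  "positive_definite A \<longleftrightarrow> square_mat A \<and> mat_adjoint A = A \<and>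
     (\<forall>v \<in> carrier_vec (dim_row A). v \<noteq> 0\<^sub>v (dim_row A) \<longrightarrow> 0 < (A *\<^sub>v v) \<bullet>c v)"

definition has_nonpositive_eigenvalue :: "complex mat \<Rightarrow> bool" where
  "has_nonpositive_eigenvalue M \<longleftrightarrow>
     (\<exists>z. eigenvalue M z \<and> \<not> (z \<in> \<real> \<and> 0 < Re z))"

end

theory Submission
  imports Defs "HOL-Analysis.Topology_Euclidean_Space"
begin

text \<open>
  Join the identity to \<open>A\<close> and to \<open>B\<close> by the segments \<open>(1 - t) I + t A\<close> and \<open>(1 - t) I + t B\<close>.
  All matrices on them are positive definite, and the value \<open>M t\<close> of the word along them goes
  continuously from the identity, all of whose eigenvalues are positive, to \<open>W(A,B)\<close>, which has
  an eigenvalue that is not positive.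

  Suppose that no \<open>M t ^ k\<close> has an eigenvalue that is not positive. Then every eigenvalue of every
  \<open>M t\<close> has a positive \<open>k\<close>-th power, so it lies on one of the \<open>k\<close> open rays from the origin
  through the \<open>k\<close>-th roots of unity. Eigenvalues move continuously and cannot pass from one ray to
  another without meeting zero, so those that start on the positive ray stay on it: a contradiction
  at \<open>t = 1\<close>.

  To make this rigorous, let \<open>T\<close> be the set
  of \<open>t\<close> for which all eigenvalues are nonnegative reals, and \<open>S\<close> the set of those for which some
  eigenvalue lies on a ray through a root of unity other than \<open>1\<close>. Under the assumption, zero is
  never an eigenvalue, so \<open>T\<close> and \<open>S\<close> partition the unit interval; both are closed
  (\<open>closed_all_eigenvalues_in\<close> and \<open>closed_some_eigenvalue_in\<close>) and nonempty, which contradicts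
  its connectedness. This is \<open>path_power_nonpositive\<close>. In the real case the same path of real
  matrices is embedded into the complex ones.
\<close>

section \<open>Words along the segment from the identity\<close>

text \<open>
  The scalar \<open>c\<close> has the type of the entries, so that the real and the complex case share this
  definition and \<open>segment_mat_hom\<close> translates between them.
\<close>
definition segment_mat :: "'a::comm_ring_1 \<Rightarrow> 'a mat \<Rightarrow> 'a mat" where
  "segment_mat c A = (1 - c) \<cdot>\<^sub>m 1\<^sub>m (dim_row A) + c \<cdot>\<^sub>m A"

lemma segment_mat_carrier [simp]:
  "A \<in> carrier_mat n n \<Longrightarrow> segment_mat c A \<in> carrier_mat n n"
  by (auto simp: segment_mat_def)

lemma segment_mat_0: "A \<in> carrier_mat n n \<Longrightarrow> segment_mat 0 A = 1\<^sub>m n"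
  by (rule eq_matI) (auto simp: segment_mat_def)

lemma segment_mat_1: "A \<in> carrier_mat n n \<Longrightarrow> segment_mat 1 A = A"
  by (rule eq_matI) (auto simp: segment_mat_def)

lemma (in comm_ring_hom) segment_mat_hom:
  "A \<in> carrier_mat n n \<Longrightarrow> mat\<^sub>h (segment_mat c A) = segment_mat (hom c) (mat\<^sub>h A)"
  by (rule eq_matI) (auto simp: segment_mat_def hom_distribs)

lemma letter_mat_carrier [simp]:
  "A \<in> carrier_mat n n \<Longrightarrow> B \<in> carrier_mat n n \<Longrightarrow> letter_mat x A B \<in> carrier_mat n n"
  by (cases x) auto

lemma word_mat_carrier [simp]:
  "A \<in> carrier_mat n n \<Longrightarrow> B \<in> carrier_mat n n \<Longrightarrow> word_mat W A B \<in> carrier_mat n n"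
  by (induction W) (auto intro: mult_carrier_mat[OF letter_mat_carrier])

lemma word_mat_one: "word_mat W (1\<^sub>m n) (1\<^sub>m n) = 1\<^sub>m n"
proof (induction W)
  case (Cons x W)
  then show ?case by (cases x) auto
qed auto

lemma (in comm_ring_hom) word_mat_hom:
  assumes "A \<in> carrier_mat n n" "B \<in> carrier_mat n n"
  shows "mat\<^sub>h (word_mat W A B) = word_mat W (mat\<^sub>h A) (mat\<^sub>h B)"
proof (induction W)
  case Nil
  then show ?case using assms by (simp add: mat_hom_one)
next
  case (Cons x W)
  have "mat\<^sub>h (letter_mat x A B) = letter_mat x (mat\<^sub>h A) (mat\<^sub>h B)"
    by (cases x) auto
  then show ?case
    using mat_hom_mult[OF letter_mat_carrier[OF assms] word_mat_carrier[OF assms]] Cons by simp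
qed

section \<open>Positive definite matrices\<close>

lemma positive_definite_iff:
  fixes A :: "'a::conjugatable_ordered_field mat"
  assumes A: "A \<in> carrier_mat n n"
  shows "positive_definite A \<longleftrightarrow>
    (\<forall>i<n. \<forall>j<n. conjugate (A $$ (j, i)) = A $$ (i, j)) \<and>
    (\<forall>v\<in>carrier_vec n. v \<noteq> 0\<^sub>v n \<longrightarrow> 0 < (A *\<^sub>v v) \<bullet>c v)"
proof -
  have "mat_adjoint A = A \<longleftrightarrow> (\<forall>i<n. \<forall>j<n. conjugate (A $$ (j, i)) = A $$ (i, j))"
    using A by (auto simp: mat_eq_iff mat_adjoint_def mat_of_rows_def)
  then show ?thesis
    using A by (auto simp: positive_definite_def)
qed

lemma conjugate_1 [simp]: "conjugate (1::'a::conjugatable_field) = 1"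
  by (metis conjugate_dist_mul conjugate_zero_iff mult_cancel_left2 mult_1 one_neq_zero)

lemma positive_definite_one:
  "positive_definite (1\<^sub>m n :: 'a::conjugatable_ordered_field mat)"
  by (subst positive_definite_iff[where n = n]) auto

lemma positive_definite_add:
  assumes A: "A \<in> carrier_mat n n" and B: "B \<in> carrier_mat n n"
    and "positive_definite A" "positive_definite B"
  shows "positive_definite (A + B)"
proof -
  have "((A + B) *\<^sub>v v) \<bullet>c v = (A *\<^sub>v v) \<bullet>c v + (B *\<^sub>v v) \<bullet>c v"
    if v: "v \<in> carrier_vec n" for v
    using A B v by (simp add: add_mult_distrib_mat_vec[of _ n n] add_scalar_prod_distrib[of _ n])
  then show ?thesis
    using assms by (simp add: positive_definite_iff[of _ n] conjugate_dist_add add_pos_pos)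
qed

text \<open>
  The axioms of \<open>conjugatable_ordered_field\<close> relate multiplication to the order only through
  \<open>a * conjugate a \<ge> 0\<close>, so the positivity of the scalar is expressed by its action on positive
  elements.
\<close>
lemma positive_definite_smult:
  assumes A: "A \<in> carrier_mat n n" and "positive_definite A"
    and "conjugate c = c" and "\<And>x. 0 < x \<Longrightarrow> 0 < c * x"
  shows "positive_definite (c \<cdot>\<^sub>m A)"
proof -
  have "((c \<cdot>\<^sub>m A) *\<^sub>v v) \<bullet>c v = c * ((A *\<^sub>v v) \<bullet>c v)" if v: "v \<in> carrier_vec n" for v
  proof -
    have "(c \<cdot>\<^sub>m A) *\<^sub>v v = c \<cdot>\<^sub>v (A *\<^sub>v v)"
      using A v by (intro eq_vecI) auto
    then show ?thesis
      using A v by simp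
  qed
  then show ?thesis
    using assms by (simp add: positive_definite_iff[of _ n] conjugate_dist_mul)
qed

lemma positive_definite_segment_mat:
  assumes A: "A \<in> carrier_mat n n" and pd: "positive_definite A"
    and "conjugate c = c"
    and c: "c = 0 \<or> (\<forall>x>0. 0 < c * x)" and c': "c = 1 \<or> (\<forall>x>0. 0 < (1 - c) * x)"
  shows "positive_definite (segment_mat c A)"
proof -
  have conj: "conjugate (1 - c) = 1 - c"
    using \<open>conjugate c = c\<close> conjugate_dist_add[of 1 "- c"] by (simp add: conjugate_neg)
  (* At the two ends one summand vanishes and is not positive definite. *)
  consider "c = 0" | "c = 1" | "\<forall>x>0. 0 < c * x" "\<forall>x>0. 0 < (1 - c) * x"
    using c c' by blast
  then show ?thesis
  proof cases
    case 1
    then show ?thesis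
      using segment_mat_0[OF A] by (simp add: positive_definite_one)
  next
    case 2
    then show ?thesis
      using segment_mat_1[OF A] pd by simp
  next
    case 3
    then show ?thesis
      unfolding segment_mat_def using A pd conj \<open>conjugate c = c\<close>
      by (intro positive_definite_add[of _ n] positive_definite_smult[of _ n] positive_definite_one) auto
  qed
qed

section \<open>Continuity of the characteristic polynomial\<close>

lemma continuous_on_det:
  fixes F :: "'b::topological_space \<Rightarrow> complex mat"
  assumes "\<And>x. x \<in> X \<Longrightarrow> F x \<in> carrier_mat n n"
    and "\<And>i j. i < n \<Longrightarrow> j < n \<Longrightarrow> continuous_on X (\<lambda>x. F x $$ (i, j))"
  shows "continuous_on X (\<lambda>x. det (F x))"
proof -
  have "continuous_on X (\<lambda>x. \<Sum>p \<in> {p. p permutes {0..<n}}.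
          signof p * (\<Prod>i = 0..<n. F x $$ (i, p i)))"
    using assms(2) by (intro continuous_intros) (auto dest: permutes_in_image)
  then show ?thesis
    by (rule continuous_on_cong[THEN iffD1, rotated -1]) (auto simp: det_def'[OF assms(1)])
qed

lemma continuous_on_char_poly:
  fixes F :: "'b::topological_space \<Rightarrow> complex mat"
  assumes "\<And>x. x \<in> X \<Longrightarrow> F x \<in> carrier_mat n n"
    and "\<And>i j. i < n \<Longrightarrow> j < n \<Longrightarrow> continuous_on X (\<lambda>x. F x $$ (i, j))"
    and "continuous_on X g"
  shows "continuous_on X (\<lambda>x. poly (char_poly (F x)) (g x))"
proof -
  have "continuous_on X (\<lambda>x. det (- char_matrix (F x) (g x)))"
  proof (rule continuous_on_det[where n = n])
    fix i j assume "i < n" "j < n"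
    then have "continuous_on X (\<lambda>x. - (F x $$ (i, j) - g x * (if i = j then 1 else 0)))"
      using assms by (intro continuous_intros) auto
    then show "continuous_on X (\<lambda>x. (- char_matrix (F x) (g x)) $$ (i, j))"
      by (rule continuous_on_cong[THEN iffD1, rotated -1])
        (use assms(1) \<open>i < n\<close> \<open>j < n\<close> in \<open>fastforce simp: char_matrix_def\<close>)+
  qed (use assms(1) in auto)
  then show ?thesis
    by (rule continuous_on_cong[THEN iffD1, rotated -1]) (auto simp: char_poly_matrix[OF assms(1)])
qed

lemma continuous_on_word_mat:
  fixes F G :: "'b::topological_space \<Rightarrow> complex mat"
  assumes "\<And>x. x \<in> X \<Longrightarrow> F x \<in> carrier_mat n n" "\<And>x. x \<in> X \<Longrightarrow> G x \<in> carrier_mat n n"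
    and "\<And>i j. i < n \<Longrightarrow> j < n \<Longrightarrow> continuous_on X (\<lambda>x. F x $$ (i, j))"
    and "\<And>i j. i < n \<Longrightarrow> j < n \<Longrightarrow> continuous_on X (\<lambda>x. G x $$ (i, j))"
    and "i < n" "j < n"
  shows "continuous_on X (\<lambda>x. word_mat W (F x) (G x) $$ (i, j))"
  using \<open>i < n\<close>
proof (induction W arbitrary: i)
  case Nil
  have "continuous_on X (\<lambda>x. if i = j then 1 else 0 :: complex)"
    by simp
  then show ?case
    by (rule continuous_on_cong[THEN iffD1, rotated -1])
      (use assms(1) Nil \<open>j < n\<close> in \<open>fastforce\<close>)+
next
  case (Cons a W)
  have "continuous_on X (\<lambda>x. letter_mat a (F x) (G x) $$ (i, l))" if "l < n" for l
    using assms(3,4) that Cons.prems by (cases a) auto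
  then have "continuous_on X (\<lambda>x. \<Sum>l = 0..<n.
      letter_mat a (F x) (G x) $$ (i, l) * word_mat W (F x) (G x) $$ (l, j))"
    using Cons.IH by (intro continuous_intros) auto
  moreover have "word_mat (a # W) (F x) (G x) $$ (i, j) = (\<Sum>l = 0..<n.
      letter_mat a (F x) (G x) $$ (i, l) * word_mat W (F x) (G x) $$ (l, j))" if "x \<in> X" for x
    using Cons.prems \<open>j < n\<close>
      letter_mat_carrier[OF assms(1,2)[OF that], of a] word_mat_carrier[OF assms(1,2)[OF that], of W]
    by (simp add: scalar_prod_def)
  ultimately show ?case
    by (simp cong: continuous_on_cong)
qed

section \<open>Bounds for eigenvalues\<close>

text \<open>
  The characteristic polynomial is the product of the \<open>n\<close> factors \<open>z - a\<close> over the eigenvalues \<open>a\<close>,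
  and each factor has modulus at least the distance from \<open>z\<close> to \<open>S\<close>.
\<close>
lemma norm_char_poly_ge_infdist:
  fixes A :: "complex mat"
  assumes A: "A \<in> carrier_mat n n" and "{z. eigenvalue A z} \<subseteq> S"
  shows "infdist z S ^ n \<le> norm (poly (char_poly A) z)"
proof -
  obtain as where as: "char_poly A = (\<Prod>a\<leftarrow>as. [:- a, 1:])" "length as = n"
    using char_poly_factorized[OF A] by auto
  have "set as \<subseteq> {z. eigenvalue A z}"
    unfolding eigenvalue_root_char_poly[OF A] as(1) by (auto simp: poly_prod_list prod_list_zero_iff)
  then have "set as \<subseteq> S"
    using assms(2) by blast
  then have "infdist z S ^ length as \<le> norm (poly (\<Prod>a\<leftarrow>as. [:- a, 1:]) z)"
  proof (induction as)
    case (Cons a as)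
    then have "infdist z S \<le> norm (z - a)"
      by (simp add: infdist_le flip: dist_norm)
    moreover have "norm (poly (\<Prod>a\<leftarrow>a # as. [:- a, 1:]) z) =
        norm (z - a) * norm (poly (\<Prod>a\<leftarrow>as. [:- a, 1:]) z)"
      unfolding list.map prod_list.Cons poly_mult norm_mult by simp
    ultimately show ?case
      using Cons by (auto simp del: poly_mult simp: infdist_nonneg intro!: mult_mono)
  qed simp
  then show ?thesis
    using as by simp
qed

text \<open>Compare the two sides of \<open>A v = z v\<close> in a coordinate in which the eigenvector \<open>v\<close> is largest.\<close>
lemma eigenvalue_norm_le:
  fixes A :: "complex mat"
  assumes A: "A \<in> carrier_mat n n" and ev: "eigenvalue A z"
    and b: "\<And>i j. i < n \<Longrightarrow> j < n \<Longrightarrow> norm (A $$ (i, j)) \<le> b"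
  shows "norm z \<le> n * b"
proof -
  obtain v where v: "v \<in> carrier_vec n" "v \<noteq> 0\<^sub>v n" "A *\<^sub>v v = z \<cdot>\<^sub>v v"
    using ev A unfolding eigenvalue_def eigenvector_def by auto
  have "n > 0"
    using eigenvalue_imp_nonzero_dim[OF A ev] .
  then obtain i where i: "i < n" "\<And>j. j < n \<Longrightarrow> norm (v $ j) \<le> norm (v $ i)"
    using ex_min_if_finite[of "(\<lambda>j. - norm (v $ j)) ` {..<n}"] by (fastforce simp: not_less)
  have "v $ i \<noteq> 0"
  proof
    assume "v $ i = 0"
    then have "v = 0\<^sub>v n"
      using i v(1) by (intro eq_vecI) auto
    then show False using v by simp
  qed
  have "z * v $ i = (A *\<^sub>v v) $ i"
    using v(1) i by (simp add: v(3))
  also have "\<dots> = (\<Sum>j = 0..<n. A $$ (i, j) * v $ j)"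
    using v(1) A i by (simp add: scalar_prod_def)
  finally have "norm z * norm (v $ i) = norm (\<Sum>j = 0..<n. A $$ (i, j) * v $ j)"
    by (metis norm_mult)
  also have "\<dots> \<le> (\<Sum>j = 0..<n. b * norm (v $ i))"
    by (rule sum_norm_le)
      (use i b in \<open>auto simp: norm_mult intro!: mult_mono intro: order_trans[OF norm_ge_zero]\<close>)
  finally show ?thesis
    using \<open>v $ i \<noteq> 0\<close> by (simp flip: mult.assoc)
qed

lemma eigenvalue_pow:
  assumes A: "A \<in> carrier_mat n n" and ev: "eigenvalue A z"
  shows "eigenvalue (A ^\<^sub>m k) (z ^ k)"
  using eigenvector_pow[OF A] assms unfolding eigenvalue_def eigenvector_def by auto

section \<open>The rays through the roots of unity\<close>

text \<open>Zero is included to make the set closed.\<close>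
abbreviation nonneg_reals :: "complex set" where
  "nonneg_reals \<equiv> complex_of_real ` {0..}"

lemma nonneg_reals_iff: "z \<in> nonneg_reals \<longleftrightarrow> z = 0 \<or> (z \<in> \<real> \<and> 0 < Re z)"
  by (auto simp: image_iff elim!: Reals_cases)

lemma closed_nonneg_reals: "closed nonneg_reals"
proof -
  have "nonneg_reals = {z. Im z = 0} \<inter> {z. 0 \<le> Re z}"
    by (auto simp: image_iff complex_eq_iff)
  moreover have "closed {z. Im z = 0}" "closed {z. 0 \<le> Re z}"
    by (intro closed_Collect_eq closed_Collect_le continuous_intros)+
  ultimately show ?thesis
    by auto
qed

text \<open>
  The closed rays from the origin through the \<open>k\<close>-th roots of unity other than \<open>1\<close>. Each is written
  as a preimage of the nonnegative reals, from which its closedness is immediate.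
\<close>
definition other_root_rays :: "nat \<Rightarrow> complex set" where
  "other_root_rays k = (\<Union>\<omega>\<in>{\<omega>. \<omega> ^ k = 1} - {1}. (\<lambda>z. z / \<omega>) -` nonneg_reals)"

lemma closed_other_root_rays:
  assumes "0 < k"
  shows "closed (other_root_rays k)"
  unfolding other_root_rays_def
proof (intro closed_UN ballI)
  show "finite ({\<omega>::complex. \<omega> ^ k = 1} - {1})"
    using assms by (simp add: finite_roots_unity)
  show "closed ((\<lambda>z. z / \<omega>) -` nonneg_reals)" if "\<omega> \<in> {\<omega>. \<omega> ^ k = 1} - {1}" for \<omega>
  proof (intro closed_vimage closed_nonneg_reals)
    have "\<omega> \<noteq> 0"
      using that assms by (auto simp: zero_power)
    then show "continuous_on UNIV (\<lambda>z. z / \<omega>)"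
      by (intro continuous_intros) auto
  qed
qed

text \<open>
  A nonzero complex number has positive \<open>k\<close>-th power only if its direction \<open>z / \<bar>z\<bar>\<close> is a \<open>k\<close>-th root
  of unity. Distinct rays share only the origin, hence the dichotomy.
\<close>
lemma other_root_rays_iff:
  assumes "0 < k" and zk: "z ^ k \<in> \<real>" "0 < Re (z ^ k)"
  shows "z \<in> other_root_rays k \<longleftrightarrow> z \<notin> nonneg_reals"
proof
  have "z \<noteq> 0"
    using assms by (auto simp: zero_power)
  assume "z \<in> other_root_rays k"
  then obtain \<omega> r where \<omega>: "\<omega> ^ k = 1" "\<omega> \<noteq> 1" and r: "z / \<omega> = of_real r" "0 \<le> r"
    by (auto simp: other_root_rays_def)
  have "\<omega> \<noteq> 0"
    using \<omega> \<open>0 < k\<close> by (auto simp: zero_power)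
  then have z: "z = of_real r * \<omega>" and "r > 0"
    using r \<open>z \<noteq> 0\<close> by (auto simp: field_simps less_le)
  have "norm \<omega> = 1"
    using arg_cong[OF \<omega>(1), of norm] \<open>0 < k\<close> power_eq_iff_eq_base[of k "norm \<omega>" 1]
    by (simp add: norm_power)
  show "z \<notin> nonneg_reals"
  proof
    assume "z \<in> nonneg_reals"
    then have "Im \<omega> = 0" "0 < Re \<omega>"
      using \<open>r > 0\<close> \<open>z \<noteq> 0\<close>
      by (auto simp: nonneg_reals_iff z complex_is_Real_iff zero_less_mult_iff)
    then have "\<omega> = 1"
      using \<open>norm \<omega> = 1\<close> by (simp add: complex_eq_iff cmod_def)
    with \<omega> show False
      by simp
  qed
next
  assume z: "z \<notin> nonneg_reals"
  then have "z \<noteq> 0"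
    by (auto simp: nonneg_reals_iff)
  define \<omega> where "\<omega> = z / of_real (norm z)"
  obtain s where s: "z ^ k = of_real s" "s > 0"
    using zk by (auto elim!: Reals_cases)
  then have "s = norm z ^ k"
    by (metis abs_of_pos norm_of_real norm_power)
  then have "\<omega> ^ k = 1"
    using s \<open>z \<noteq> 0\<close> by (simp add: \<omega>_def power_divide)
  moreover have "\<omega> \<noteq> 1"
    using z \<open>z \<noteq> 0\<close> by (auto simp: \<omega>_def image_iff)
  moreover have "z / \<omega> = of_real (norm z)"
    using \<open>z \<noteq> 0\<close> by (simp add: \<omega>_def)
  ultimately show "z \<in> other_root_rays k"
    by (auto simp: other_root_rays_def intro!: bexI[of _ \<omega>])
qed

section \<open>Closed conditions on the spectrum\<close>

text \<open>
  That all eigenvalues lie in \<open>R\<close> is equivalent to the inequalities of \<open>norm_char_poly_ge_infdist\<close> for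
  all points \<open>z\<close>, and each of these is a closed condition on \<open>t\<close>.
\<close>
lemma closed_all_eigenvalues_in:
  fixes M :: "'b::topological_space \<Rightarrow> complex mat"
  assumes M: "\<And>t. t \<in> X \<Longrightarrow> M t \<in> carrier_mat n n"
    and cont: "\<And>i j. i < n \<Longrightarrow> j < n \<Longrightarrow> continuous_on X (\<lambda>t. M t $$ (i, j))"
    and "closed X" and R: "closed R" "R \<noteq> {}"
  shows "closed {t \<in> X. \<forall>z. eigenvalue (M t) z \<longrightarrow> z \<in> R}"
proof -
  let ?p = "\<lambda>t z. poly (char_poly (M t)) z"
  have "{t \<in> X. \<forall>z. eigenvalue (M t) z \<longrightarrow> z \<in> R} = (\<Inter>z. {t \<in> X. infdist z R ^ n \<le> norm (?p t z)})"
  proof (intro equalityI subsetI)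
    fix t assume "t \<in> {t \<in> X. \<forall>z. eigenvalue (M t) z \<longrightarrow> z \<in> R}"
    then show "t \<in> (\<Inter>z. {t \<in> X. infdist z R ^ n \<le> norm (?p t z)})"
      using norm_char_poly_ge_infdist[OF M, of t R] by auto
  next
    fix t assume "t \<in> (\<Inter>z. {t \<in> X. infdist z R ^ n \<le> norm (?p t z)})"
    then have t: "t \<in> X" "\<And>z. infdist z R ^ n \<le> norm (?p t z)"
      by auto
    have "z \<in> R" if "eigenvalue (M t) z" for z
    proof -
      have "?p t z = 0"
        using that eigenvalue_root_char_poly[OF M[OF t(1)]] by simp
      then have "infdist z R ^ n \<le> 0"
        using t(2)[of z] by simp
      then have "infdist z R = 0"
        using infdist_nonneg[of z R] by (metis less_eq_real_def not_less zero_less_power)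
      then show "z \<in> R"
        using R by (simp add: in_closed_iff_infdist_zero)
    qed
    then show "t \<in> {t \<in> X. \<forall>z. eigenvalue (M t) z \<longrightarrow> z \<in> R}"
      using t by auto
  qed
  also have "closed \<dots>"
    by (intro closed_INT ballI continuous_on_closed_Collect_le continuous_on_norm continuous_on_const
        continuous_on_char_poly[OF M cont]) (use \<open>closed X\<close> in auto)
  finally show ?thesis .
qed

lemma bounded_entries:
  fixes M :: "'b::topological_space \<Rightarrow> complex mat"
  assumes "\<And>i j. i < n \<Longrightarrow> j < n \<Longrightarrow> continuous_on X (\<lambda>t. M t $$ (i, j))"
    and "compact X"
  shows "\<exists>b. \<forall>t\<in>X. \<forall>i<n. \<forall>j<n. norm (M t $$ (i, j)) \<le> b"
proof (cases "X = {}")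
  case False
  let ?g = "\<lambda>t. \<Sum>i<n. \<Sum>j<n. norm (M t $$ (i, j))"
  have "continuous_on X ?g"
    using assms by (intro continuous_intros) auto
  then obtain t0 where "\<forall>t\<in>X. ?g t \<le> ?g t0"
    using continuous_attains_sup[of X ?g] False \<open>compact X\<close> by auto
  moreover have "norm (M t $$ (i, j)) \<le> ?g t" if "i < n" "j < n" for t i j
  proof -
    have "norm (M t $$ (i, j)) \<le> (\<Sum>j<n. norm (M t $$ (i, j)))"
      using that by (intro member_le_sum) auto
    also have "\<dots> \<le> ?g t"
      using that
      by (intro member_le_sum[of i "{..<n}" "\<lambda>i. \<Sum>j<n. norm (M t $$ (i, j))"] sum_nonneg) auto
    finally show ?thesis .
  qed
  ultimately show ?thesis
    by (meson order_trans)
qed auto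

text \<open>
  The pairs of a parameter and an eigenvalue in \<open>R\<close> form a compact set, because the eigenvalues are
  uniformly bounded on a compact parameter set. Its projection to the parameters is then compact.
\<close>
lemma closed_some_eigenvalue_in:
  fixes M :: "'b::t2_space \<Rightarrow> complex mat"
  assumes M: "\<And>t. t \<in> X \<Longrightarrow> M t \<in> carrier_mat n n"
    and cont: "\<And>i j. i < n \<Longrightarrow> j < n \<Longrightarrow> continuous_on X (\<lambda>t. M t $$ (i, j))"
    and "compact X" and "closed R"
  shows "closed {t \<in> X. \<exists>z\<in>R. eigenvalue (M t) z}"
proof -
  obtain b where b: "\<And>t i j. t \<in> X \<Longrightarrow> i < n \<Longrightarrow> j < n \<Longrightarrow> norm (M t $$ (i, j)) \<le> b"
    using bounded_entries[of n X M, OF cont \<open>compact X\<close>] by auto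
  define Z where "Z = cball 0 (n * b) \<inter> R"
  define K where "K = {x \<in> X \<times> Z. poly (char_poly (M (fst x))) (snd x) = 0}"
  have "compact Z"
    unfolding Z_def by (intro compact_Int_closed compact_cball \<open>closed R\<close>)
  have "continuous_on (X \<times> Z) (\<lambda>x. poly (char_poly (M (fst x))) (snd x))"
  proof (rule continuous_on_char_poly)
    show "continuous_on (X \<times> Z) (\<lambda>x. M (fst x) $$ (i, j))" if "i < n" "j < n" for i j
      by (rule continuous_on_compose2[OF cont[OF that]]) (auto intro: continuous_intros)
  qed (auto intro: M continuous_intros)
  then have "closed K"
    unfolding K_def using \<open>compact X\<close> \<open>compact Z\<close>
    by (intro continuous_closed_preimage_constant closed_Times compact_imp_closed)
  moreover have "K = (X \<times> Z) \<inter> K"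
    by (auto simp: K_def)
  ultimately have "compact K"
    using compact_Int_closed[OF compact_Times[OF \<open>compact X\<close> \<open>compact Z\<close>]] by metis
  then have "compact (fst ` K)"
    by (intro compact_continuous_image continuous_intros)
  moreover have "fst ` K = {t \<in> X. \<exists>z\<in>R. eigenvalue (M t) z}"
  proof (intro equalityI subsetI)
    fix t assume "t \<in> fst ` K"
    then show "t \<in> {t \<in> X. \<exists>z\<in>R. eigenvalue (M t) z}"
      using eigenvalue_root_char_poly[OF M] by (auto simp: K_def Z_def)
  next
    fix t assume "t \<in> {t \<in> X. \<exists>z\<in>R. eigenvalue (M t) z}"
    then obtain z where t: "t \<in> X" and z: "z \<in> R" and ev: "eigenvalue (M t) z"
      by auto
    have "norm z \<le> n * b"
      using eigenvalue_norm_le[OF M[OF t] ev b[OF t]] .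
    then have "(t, z) \<in> K"
      using t z ev eigenvalue_root_char_poly[OF M[OF t]] by (simp add: K_def Z_def)
    then show "t \<in> fst ` K"
      by force
  qed
  ultimately show ?thesis
    by (simp add: compact_imp_closed)
qed

section \<open>The connectedness argument\<close>

text \<open>
  If the conclusion fails, every eigenvalue on the path has a positive \<open>k\<close>-th power and is in
  particular nonzero. It can then leave the positive reals only by jumping to another ray through a
  root of unity, and the connectedness of the interval excludes such jumps.
\<close>
lemma path_power_nonpositive:
  fixes M :: "real \<Rightarrow> complex mat"
  assumes M: "\<And>t. t \<in> {0..1} \<Longrightarrow> M t \<in> carrier_mat n n"
    and cont: "\<And>i j. i < n \<Longrightarrow> j < n \<Longrightarrow> continuous_on {0..1} (\<lambda>t. M t $$ (i, j))"
    and M0: "\<not> has_nonpositive_eigenvalue (M 0)"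
    and M1: "has_nonpositive_eigenvalue (M 1)"
    and k: "0 < k"
  shows "\<exists>t\<in>{0..1}. has_nonpositive_eigenvalue (M t ^\<^sub>m k)"
proof (rule ccontr)
  assume "\<not> ?thesis"
  then have pow: "z ^ k \<in> \<real>" "0 < Re (z ^ k)" if "t \<in> {0..1}" "eigenvalue (M t) z" for t z
    using eigenvalue_pow[OF M[OF that(1)] that(2)] that(1)
    unfolding has_nonpositive_eigenvalue_def by blast+
  have nonzero: "z \<noteq> 0" if "t \<in> {0..1}" "eigenvalue (M t) z" for t z
    using pow(2)[OF that] k by (auto simp: zero_power)
  define T where "T = {t \<in> {0..1}. \<forall>z. eigenvalue (M t) z \<longrightarrow> z \<in> nonneg_reals}"
  define S where "S = {t \<in> {0..1}. \<exists>z\<in>other_root_rays k. eigenvalue (M t) z}"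
  have T_eq: "T = {t \<in> {0..1}. \<not> has_nonpositive_eigenvalue (M t)}"
    using nonzero by (auto simp: T_def has_nonpositive_eigenvalue_def nonneg_reals_iff)
  have "S = {t \<in> {0..1}. \<exists>z. eigenvalue (M t) z \<and> z \<notin> nonneg_reals}"
    using other_root_rays_iff[OF k pow] by (auto simp: S_def)
  then have "{0..1} \<subseteq> T \<union> S" "T \<inter> S \<inter> {0..1} = {}"
    by (auto simp: T_def)
  moreover from this(1) have "1 \<in> T \<union> S"
    by (rule subsetD) simp
  with M0 M1 have "0 \<in> T \<inter> {0..1}" "1 \<in> S \<inter> {0..1}"
    by (auto simp: T_eq S_def)
  moreover have "closed T"
    unfolding T_def using closed_nonneg_reals
    by (intro closed_all_eigenvalues_in[OF M cont]) auto
  moreover have "closed S"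
    unfolding S_def using closed_other_root_rays[OF k]
    by (intro closed_some_eigenvalue_in[OF M cont]) auto
  moreover have "connected {0..1::real}"
    by (rule connected_Icc)
  ultimately show False
    unfolding connected_closed by blast
qed

lemma eigenvalue_one_mat: "eigenvalue (1\<^sub>m n :: complex mat) z \<Longrightarrow> z = 1"
  using char_poly_upper_triangular[of "1\<^sub>m n :: complex mat" n]
  by (auto simp: eigenvalue_root_char_poly[of _ n] diag_mat_def poly_prod_list prod_list_zero_iff
      comp_def)

lemma word_power_nonpositive:
  fixes A B :: "complex mat"
  assumes A: "A \<in> carrier_mat n n" and B: "B \<in> carrier_mat n n"
    and "has_nonpositive_eigenvalue (word_mat W A B)" and "0 < k"
  shows "\<exists>t::real\<in>{0..1}. has_nonpositive_eigenvalue
    (word_mat W (segment_mat (of_real t) A) (segment_mat (of_real t) B) ^\<^sub>m k)"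
proof (rule path_power_nonpositive)
  have cont: "continuous_on {0..1} (\<lambda>t::real. segment_mat (of_real t) C $$ (i, j))"
    if "C \<in> carrier_mat n n" "i < n" "j < n" for C :: "complex mat" and i j
    using that by (auto simp: segment_mat_def intro!: continuous_intros)
  show "continuous_on {0..1} (\<lambda>t::real. word_mat W (segment_mat (of_real t) A)
      (segment_mat (of_real t) B) $$ (i, j))" if "i < n" "j < n" for i j
    using that A B by (intro continuous_on_word_mat[where n = n] cont) auto
  show "\<not> has_nonpositive_eigenvalue
      (word_mat W (segment_mat (of_real 0) A) (segment_mat (of_real 0) B))"
    using A B by (auto simp: segment_mat_0 word_mat_one has_nonpositive_eigenvalue_def
        dest: eigenvalue_one_mat)
  show "has_nonpositive_eigenvalue
      (word_mat W (segment_mat (of_real 1) A) (segment_mat (of_real 1) B))"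
    using assms by (simp add: segment_mat_1)
  show "word_mat W (segment_mat (of_real t) A) (segment_mat (of_real t) B) \<in> carrier_mat n n" for t
    using A B by simp
qed fact

theorem theorem1p8:
  fixes W :: "letter list"
  shows
    "((\<exists>n. \<exists>A \<in> carrier_mat n n. \<exists>B \<in> carrier_mat n n.
         positive_definite (A :: real mat) \<and> positive_definite B \<and>
         has_nonpositive_eigenvalue (map_mat complex_of_real (word_mat W A B)))
      \<longrightarrow> (\<forall>k::nat. 0 < k \<longrightarrow>
        (\<exists>m. \<exists>A' \<in> carrier_mat m m. \<exists>B' \<in> carrier_mat m m.
           positive_definite (A' :: real mat) \<and> positive_definite B' \<and>
           has_nonpositive_eigenvalue (map_mat complex_of_real (word_mat W A' B' ^\<^sub>m k)))))
   \<and> ((\<exists>n. \<exists>A \<in> carrier_mat n n. \<exists>B \<in> carrier_mat n n.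
         positive_definite (A :: complex mat) \<and> positive_definite B \<and>
         has_nonpositive_eigenvalue (word_mat W A B))
      \<longrightarrow> (\<forall>k::nat. 0 < k \<longrightarrow>
        (\<exists>m. \<exists>A' \<in> carrier_mat m m. \<exists>B' \<in> carrier_mat m m.
           positive_definite (A' :: complex mat) \<and> positive_definite B' \<and>
           has_nonpositive_eigenvalue (word_mat W A' B' ^\<^sub>m k))))"
proof (intro conjI impI allI; elim exE bexE conjE)
  fix k n :: nat and A B :: "real mat"
  assume "0 < k" and A: "A \<in> carrier_mat n n" "positive_definite A"
    and B: "B \<in> carrier_mat n n" "positive_definite B"
    and W: "has_nonpositive_eigenvalue (map_mat complex_of_real (word_mat W A B))"
  have pd: "positive_definite (segment_mat t C)"
    if "C \<in> carrier_mat n n" "positive_definite C" "t \<in> {0..1}" for C :: "real mat" and t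
    using that by (intro positive_definite_segment_mat[of _ n]) (auto simp: le_less)
  obtain t :: real where t: "t \<in> {0..1}" and
    "has_nonpositive_eigenvalue (word_mat W
       (segment_mat (of_real t) (map_mat of_real A)) (segment_mat (of_real t) (map_mat of_real B)) ^\<^sub>m k)"
    using word_power_nonpositive[of "map_mat of_real A" n "map_mat of_real B" W k] A B W \<open>0 < k\<close>
    by (auto simp: of_real_hom.word_mat_hom[of _ n])
  moreover have "map_mat complex_of_real (word_mat W (segment_mat t A) (segment_mat t B) ^\<^sub>m k) =
    word_mat W (segment_mat (of_real t) (map_mat of_real A)) (segment_mat (of_real t) (map_mat of_real B)) ^\<^sub>m k"
    using A(1) B(1)
    by (simp add: of_real_hom.mat_hom_pow[of _ n] of_real_hom.word_mat_hom[of _ n]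
        of_real_hom.segment_mat_hom[of _ n])
  ultimately show "\<exists>m. \<exists>A' \<in> carrier_mat m m. \<exists>B' \<in> carrier_mat m m.
      positive_definite (A' :: real mat) \<and> positive_definite B' \<and>
      has_nonpositive_eigenvalue (map_mat complex_of_real (word_mat W A' B' ^\<^sub>m k))"
    using pd[OF A t] pd[OF B t] segment_mat_carrier[OF A(1)] segment_mat_carrier[OF B(1)] by metis
next
  fix k n :: nat and A B :: "complex mat"
  assume "0 < k" and A: "A \<in> carrier_mat n n" "positive_definite A"
    and B: "B \<in> carrier_mat n n" "positive_definite B"
    and W: "has_nonpositive_eigenvalue (word_mat W A B)"
  have pd: "positive_definite (segment_mat (of_real t) C)"
    if "C \<in> carrier_mat n n" "positive_definite C" "t \<in> {0..1}" for C :: "complex mat" and t :: real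
    using that by (intro positive_definite_segment_mat[of _ n]) (auto simp: le_less less_complex_def)
  obtain t :: real where "t \<in> {0..1}" and
    "has_nonpositive_eigenvalue
      (word_mat W (segment_mat (of_real t) A) (segment_mat (of_real t) B) ^\<^sub>m k)"
    using word_power_nonpositive[OF A(1) B(1) W \<open>0 < k\<close>] by blast
  then show "\<exists>m. \<exists>A' \<in> carrier_mat m m. \<exists>B' \<in> carrier_mat m m.
      positive_definite (A' :: complex mat) \<and> positive_definite B' \<and>
      has_nonpositive_eigenvalue (word_mat W A' B' ^\<^sub>m k)"
    using pd A B segment_mat_carrier[OF A(1)] segment_mat_carrier[OF B(1)] by blast
qed

end
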